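(* Let $\mathbf{a}=[\alpha_1,\dots,\alpha_{N+1}]$ be a list of positive integers and let $f$ be the greatest common divisor of a sublist of $\mathbf{a}$. Let $J=\{i: f\nmid\alpha_i\}$, $\mathbf{a}_J=(\alpha_j)_{j\in J}$, and $$\Lambda(\mathbf{a},f)=\Big\{\mathbf{y}\in\mathbb{Z}^J:\sum_{j\in J}y_j\alpha_j\in f\mathbb{Z}\Big\}.$$ Let $s_0\in\mathbb{Z}$ and $\mathbf{s}=(s_j)_{j\in J}\in\mathbb{Z}^J$ satisfy $1=\sum_{j\in J}s_j\alpha_j+s_0f$. Let $T$ be an integer and $\boldsymbol{\xi}=(\xi_j)_{j\in J}\in\mathbb{R}^J$ with $\xi_j<0$ for all $j$. Then $$\sum_{\zeta:\zeta^f=1}\frac{\zeta^{-T}}{\prod_{j\in J}(1-\zeta^{\alpha_j}e^{\xi_j})}=f\,e^{\langle\boldsymbol{\xi},T\mathbf{s}\rangle}\sum_{\mathbf{n}\in(-T\mathbf{s}+\mathbb{R}^J_{\ge0})\cap\Lambda(\mathbf{a},f)}e^{\langle\boldsymbol{\xi},\mathbf{n}\rangle}.$$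
   Context: $\langle\cdot,\cdot\rangle$ is the standard pairing on $\mathbb{R}^J$, and $\mathbb{R}^J_{\ge0}$ is the cone of vectors with non-negative coordinates. The left-hand side is denoted $Q(\mathbf{a},f,T)(\boldsymbol{\xi})$ in the paper. *)

theory Defs
  imports "HOL-Analysis.Analysis" "HOL-Library.Sublist"
begin

text \<open>
  For a finite set \<open>J\<close> of positions, \<open>\<real>\<^sup>J\<close> is modelled by the extensional functions
  \<open>J \<rightarrow>\<^sub>E UNIV\<close> with values in the reals. Integral vectors are real vectors with integral
  coordinates, so that \<open>\<int>\<^sup>J\<close> is \<open>J \<rightarrow>\<^sub>E \<int>\<close>, a subset of \<open>\<real>\<^sup>J\<close>.
  Positions in a list count from 0.
\<close>

type_synonym rvec = "nat \<Rightarrow> real"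

definition is_gcd_of_sublist :: "nat \<Rightarrow> nat list \<Rightarrow> bool" where
  "is_gcd_of_sublist f a \<longleftrightarrow> (\<exists>b. subseq b a \<and> b \<noteq> [] \<and> f = Gcd (set b))"

definition index_set :: "nat list \<Rightarrow> nat \<Rightarrow> nat set" where
  "index_set a f = {i. i < length a \<and> \<not> f dvd a ! i}"

definition pairing :: "nat set \<Rightarrow> rvec \<Rightarrow> rvec \<Rightarrow> real" where
  "pairing J x y = (\<Sum>j\<in>J. x j * y j)"

definition scale_vec :: "nat set \<Rightarrow> real \<Rightarrow> rvec \<Rightarrow> rvec" where
  "scale_vec J c v = (\<lambda>j\<in>J. c * v j)"

definition nonneg_cone :: "nat set \<Rightarrow> rvec set" where
  "nonneg_cone J = J \<rightarrow>\<^sub>E {0..}"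

definition translate :: "nat set \<Rightarrow> rvec \<Rightarrow> rvec set \<Rightarrow> rvec set" where
  "translate J v C = (\<lambda>x. \<lambda>j\<in>J. v j + x j) ` C"

definition Lambda :: "nat list \<Rightarrow> nat \<Rightarrow> rvec set" where
  "Lambda a f = {y \<in> index_set a f \<rightarrow>\<^sub>E \<int>.
     \<exists>k::int. (\<Sum>j\<in>index_set a f. y j * real (a ! j)) = real f * of_int k}"

definition Q :: "nat list \<Rightarrow> nat \<Rightarrow> int \<Rightarrow> rvec \<Rightarrow> complex" where
  "Q a f T \<xi> = (\<Sum>\<zeta> | \<zeta> ^ f = 1.
     \<zeta> powi (- T) / (\<Prod>j\<in>index_set a f. 1 - \<zeta> ^ (a ! j) * exp (complex_of_real (\<xi> j))))"

end

theory Submission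
  imports Defs
begin

text \<open>
  Expanding each factor \<open>1 / (1 - \<zeta>\<^sup>\<alpha> e\<^sup>\<xi>)\<close> as a geometric series turns the left-hand side into
  a sum over \<open>m \<in> \<nat>\<^sup>J\<close> of \<open>e\<^bsup>\<langle>\<xi>,m\<rangle>\<^esup>\<close> times the sum of \<open>\<zeta>\<^bsup>\<langle>\<alpha>,m\<rangle> - T\<^esup>\<close> over the \<open>f\<close>-th roots of unity.
  The latter is \<open>f\<close> if \<open>f\<close> divides \<open>\<langle>\<alpha>,m\<rangle> - T\<close>, and \<open>0\<close> otherwise. Since \<open>\<langle>\<alpha>,s\<rangle> \<equiv> 1\<close> modulo \<open>f\<close>,
  this divisibility says that \<open>n = m - T s\<close> lies in \<open>\<Lambda>\<close>.
\<close>

text \<open>For infinite \<open>I\<close> both sums over \<open>I\<close> default to 0, and the zero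
  family has sum 0.\<close>

lemma has_sum_sum:
  fixes g :: "'i \<Rightarrow> 'a \<Rightarrow> 'b::topological_comm_monoid_add"
  assumes "\<And>i. i \<in> I \<Longrightarrow> (g i has_sum c i) A"
  shows "((\<lambda>x. \<Sum>i\<in>I. g i x) has_sum (\<Sum>i\<in>I. c i)) A"
  using assms
  by (induction I rule: infinite_finite_induct) (auto intro: has_sum_add)

text \<open>The Fubini-type rule \<open>infsum_prod_PiE_abs\<close> yields an equation between
  values of \<open>infsum\<close>, not summability. It is therefore applied twice: to the norms, in
  order to reach absolute summability, and then to \<open>z\<close> itself for the value.\<close>

lemma has_sum_prod_geometric_PiE:
  fixes z :: "'a \<Rightarrow> 'b::{real_normed_field, banach}"
  assumes fin: "finite A" and z: "\<And>j. j \<in> A \<Longrightarrow> norm (z j) < 1"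
  shows "((\<lambda>m. \<Prod>j\<in>A. z j ^ m j) has_sum (\<Prod>j\<in>A. 1 / (1 - z j))) (A \<rightarrow>\<^sub>E (UNIV :: nat set))"
proof -
  \<comment> \<open>The separate type variable lets \<open>geo\<close> serve both for
    \<open>z j\<close> and for the real numbers \<open>norm (z j)\<close>.\<close>
  have geo: "((\<lambda>k. x ^ k) has_sum (1 / (1 - x))) UNIV" if "norm x < 1"
    for x :: "'c::{real_normed_field, banach}"
    using that
    by (intro norm_summable_imp_has_sum) (auto intro: geometric_sums simp: norm_power)
  have abs: "(\<lambda>k. norm (z j ^ k)) summable_on UNIV" if "j \<in> A" for j
    using geo[of "norm (z j)"] z[OF that] by (auto simp: norm_power summable_on_def)
  have "infsum (\<lambda>m. \<Prod>j\<in>A. norm (z j) ^ m j) (A \<rightarrow>\<^sub>E (UNIV :: nat set))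
      = (\<Prod>j\<in>A. infsum (\<lambda>k. norm (z j) ^ k) UNIV)"
    using abs by (intro infsum_prod_PiE_abs fin) (auto simp: norm_power)
  also have "\<dots> = (\<Prod>j\<in>A. 1 / (1 - norm (z j)))"
    using z by (intro prod.cong refl infsumI geo) auto
  also have "\<dots> \<noteq> 0"
    using z fin by (force simp: prod_zero_iff)
  \<comment> \<open>A non-summable family would have \<open>infsum\<close> equal to \<open>0\<close>.\<close>
  finally have "(\<lambda>m. \<Prod>j\<in>A. norm (z j) ^ m j) summable_on (A \<rightarrow>\<^sub>E (UNIV :: nat set))"
    using infsum_not_exists by blast
  hence "(\<lambda>m. \<Prod>j\<in>A. z j ^ m j) summable_on (A \<rightarrow>\<^sub>E (UNIV :: nat set))"
    by - (rule abs_summable_summable, simp add: norm_power flip: prod_norm)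
  moreover have "infsum (\<lambda>m. \<Prod>j\<in>A. z j ^ m j) (A \<rightarrow>\<^sub>E (UNIV :: nat set))
      = (\<Prod>j\<in>A. infsum (\<lambda>k. z j ^ k) UNIV)"
    using abs by (intro infsum_prod_PiE_abs fin) auto
  moreover have "\<dots> = (\<Prod>j\<in>A. 1 / (1 - z j))"
    using z by (intro prod.cong refl infsumI geo) auto
  ultimately show ?thesis
    by (metis has_sum_infsum)
qed

text \<open>The \<open>k\<close>-th powers of the roots of unity are the powers \<open>w ^ i\<close>
  of one number \<open>w\<close>, so the sum is geometric. All \<open>n\<close> terms are 1 if
  \<open>w = 1\<close>, which happens exactly when \<open>n\<close> divides \<open>k\<close>;
  otherwise the sum vanishes because \<open>w ^ n = 1\<close>.\<close>

lemma sum_powi_roots_unity: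
  fixes n :: nat and k :: int
  assumes n: "n > 0"
  shows "(\<Sum>\<zeta> | \<zeta> ^ n = 1. (\<zeta> :: complex) powi k) = (if int n dvd k then of_nat n else 0)"
proof -
  define w where "w = cis (2 * pi * (real_of_int k / real n))"
  have "(\<Sum>\<zeta> | \<zeta> ^ n = 1. (\<zeta> :: complex) powi k) = (\<Sum>i<n. cis (2 * pi * real i / real n) powi k)"
    by (rule sum.reindex_bij_betw [OF Complex.bij_betw_roots_unity [OF n], symmetric])
  also have "\<dots> = (\<Sum>i<n. w ^ i)"
    unfolding w_def by (intro sum.cong refl) (simp add: cis_power_int Complex.DeMoivre mult_ac)
  also have "\<dots> = (if int n dvd k then of_nat n else 0)"
  proof (cases "int n dvd k")
    case True
    then obtain l where "k = int n * l" ..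
    hence "real_of_int k / real n = of_int l"
      using n by simp
    hence "w = 1"
      unfolding w_def by (metis Ints_of_int cis_multiple_2pi)
    thus ?thesis
      using True by simp
  next
    case False
    have "w \<noteq> 1"
    proof
      assume "w = 1"
      hence "cos (2 * pi * (real_of_int k / real n)) = 1"
        by (simp add: w_def complex_eq_iff)
      then obtain l :: int where "2 * pi * (real_of_int k / real n) = of_int l * 2 * pi"
        by (auto simp: cos_one_2pi_int)
      hence "real_of_int k = of_int (int n * l)"
        using n by (simp add: field_simps)
      hence "k = int n * l"
        by (simp only: of_int_eq_iff)
      thus False
        using False by simp
    qed
    moreover have "w ^ n = 1"
      using n by (simp add: w_def Complex.DeMoivre)
    ultimately show ?thesis
      using False by (simp add: geometric_sum)
  qed
  finally show ?thesis .
qed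

text \<open>A nonempty sublist has a positive entry, and \<open>Gcd\<close> is 0 only for subsets of
  \<open>{0}\<close>. With \<open>f = 0\<close> every complex number would count as a root in
  \<open>Q\<close>.\<close>

lemma is_gcd_of_sublist_pos:
  assumes "is_gcd_of_sublist f a" and "\<forall>x\<in>set a. 0 < x"
  shows "f > 0"
proof -
  obtain b where b: "subseq b a" "b \<noteq> []" "f = Gcd (set b)"
    using assms(1) by (auto simp: is_gcd_of_sublist_def)
  have "set b \<subseteq> set a"
    using b(1) by (auto elim: list_emb_set)
  hence "\<not> set b \<subseteq> {0}"
    using assms(2) b(2) by (cases b) auto
  thus ?thesis
    using b(3) Gcd_0_iff gr0I by blast
qed

text \<open>This is the identity over \<nat>-valued \<open>m\<close>, before \<open>s\<close>
  enters. The series of the individual roots are added termwise, and the root sum then acts as a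
  filter on \<open>m\<close>.\<close>

lemma has_sum_Q:
  fixes \<xi> :: rvec and f :: nat and T :: int
  assumes f: "f > 0" and neg: "\<forall>j\<in>index_set a f. \<xi> j < 0"
  shows "((\<lambda>m. complex_of_real (real f * exp (\<Sum>j\<in>index_set a f. \<xi> j * real (m j)))) has_sum Q a f T \<xi>)
    {m \<in> index_set a f \<rightarrow>\<^sub>E UNIV. int f dvd int (\<Sum>j\<in>index_set a f. m j * a ! j) - T}"
proof -
  define J where "J = index_set a f"
  define e where "e = (\<lambda>m :: nat \<Rightarrow> nat. complex_of_real (exp (\<Sum>j\<in>J. \<xi> j * real (m j))))"
  define d where "d = (\<lambda>m :: nat \<Rightarrow> nat. int (\<Sum>j\<in>J. m j * a ! j) - T)"
  have fin: "finite J"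
    by (simp add: J_def index_set_def)
  have root_term: "((\<lambda>m. e m * \<zeta> powi d m) has_sum
      \<zeta> powi (- T) / (\<Prod>j\<in>J. 1 - \<zeta> ^ (a ! j) * exp (complex_of_real (\<xi> j)))) (J \<rightarrow>\<^sub>E UNIV)"
    if \<zeta>: "\<zeta> ^ f = 1" for \<zeta> :: complex
  proof -
    have "norm \<zeta> = 1"
      using power_eq_1_iff[OF \<zeta>] f by simp
    hence "\<zeta> \<noteq> 0"
      by auto
    define z where "z = (\<lambda>j. \<zeta> ^ (a ! j) * exp (complex_of_real (\<xi> j)))"
    \<comment> \<open>Since \<zeta> has modulus 1, the modulus of \<open>z j\<close> is
      \<open>exp (\<xi> j)\<close>; this is where the sign of \<xi> gives convergence.\<close>
    have "norm (z j) < 1" if "j \<in> J" for j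
      using neg that \<open>norm \<zeta> = 1\<close> by (simp add: z_def J_def norm_mult norm_power)
    from has_sum_cmult_right[OF has_sum_prod_geometric_PiE[of J z, OF fin this], of "\<zeta> powi (- T)"]
    have "((\<lambda>m. \<zeta> powi (- T) * (\<Prod>j\<in>J. z j ^ m j)) has_sum (\<zeta> powi (- T) / (\<Prod>j\<in>J. 1 - z j)))
      (J \<rightarrow>\<^sub>E UNIV)"
      by (simp add: prod_dividef)
    moreover have "\<zeta> powi (- T) * (\<Prod>j\<in>J. z j ^ m j) = e m * \<zeta> powi d m" for m
    proof -
      have "(\<Prod>j\<in>J. z j ^ m j) = (\<Prod>j\<in>J. exp (complex_of_real (\<xi> j * real (m j)))) * (\<Prod>j\<in>J. \<zeta> ^ (m j * a ! j))"
        unfolding prod.distrib[symmetric]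
        by (intro prod.cong refl)
          (simp add: z_def power_mult_distrib mult_ac power_mult exp_of_nat_mult flip: power_mult)
      also have "\<dots> = e m * \<zeta> ^ (\<Sum>j\<in>J. m j * a ! j)"
        using fin by (simp add: e_def exp_sum power_sum of_real_exp)
      finally show ?thesis
        using \<open>\<zeta> \<noteq> 0\<close> by (simp add: d_def power_int_diff power_int_minus field_simps del: of_nat_sum)
    qed
    ultimately show ?thesis
      by (simp add: z_def)
  qed
  have "((\<lambda>m. \<Sum>\<zeta> | \<zeta> ^ f = 1. e m * \<zeta> powi d m) has_sum Q a f T \<xi>) (J \<rightarrow>\<^sub>E UNIV)"
    unfolding Q_def J_def[symmetric] by (intro has_sum_sum root_term) simp
  also have "(\<lambda>m. \<Sum>\<zeta> | \<zeta> ^ f = 1. e m * \<zeta> powi d m) = (\<lambda>m. e m * (if int f dvd d m then of_nat f else 0))"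
    unfolding sum_powi_roots_unity[OF f, symmetric] sum_distrib_left ..
  \<comment> \<open>The terms that the filter sets to 0 are dropped by shrinking the index
    set.\<close>
  also have "(\<dots> has_sum Q a f T \<xi>) (J \<rightarrow>\<^sub>E UNIV) \<longleftrightarrow>
      ((\<lambda>m. complex_of_real (real f * exp (\<Sum>j\<in>J. \<xi> j * real (m j)))) has_sum Q a f T \<xi>)
        {m \<in> J \<rightarrow>\<^sub>E UNIV. int f dvd d m}"
    by (intro has_sum_cong_neutral) (auto simp: e_def)
  finally show ?thesis
    by (simp add: J_def d_def)
qed

text \<open>Pairing the shifted vector with the entries of \<open>a\<close> gives the pairing of
  \<open>m\<close> minus \<open>T\<close>, plus the multiple \<open>T * s0\<close> of
  \<open>f\<close>, so membership in \<open>Lambda\<close> becomes the divisibility condition.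
  Conversely, adding \<open>T\<close> times \<open>s\<close> to a point of the right-hand set gives
  a nonnegative integral vector, which is some \<open>m\<close>.\<close>

lemma bij_betw_shift_lattice_points:
  fixes a :: "nat list" and f :: nat and T s0 :: int and s :: rvec
  defines "J \<equiv> index_set a f"
  assumes s: "s \<in> J \<rightarrow>\<^sub>E \<int>"
    and bezout: "1 = (\<Sum>j\<in>J. s j * real (a ! j)) + of_int s0 * real f"
  shows "bij_betw (\<lambda>m. \<lambda>j\<in>J. real (m j) - of_int T * s j)
    {m \<in> J \<rightarrow>\<^sub>E UNIV. int f dvd int (\<Sum>j\<in>J. m j * a ! j) - T}
    (translate J (scale_vec J (- of_int T) s) (nonneg_cone J) \<inter> Lambda a f)"
proof -
  define h where "h = (\<lambda>m :: nat \<Rightarrow> nat. \<lambda>j\<in>J. real (m j) - of_int T * s j)"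
  define M where "M = {m \<in> J \<rightarrow>\<^sub>E UNIV. int f dvd int (\<Sum>j\<in>J. m j * a ! j) - T}"
  define S where "S = translate J (scale_vec J (- of_int T) s) (nonneg_cone J) \<inter> Lambda a f"
  have Lambda_iff: "h m \<in> Lambda a f \<longleftrightarrow> int f dvd int (\<Sum>j\<in>J. m j * a ! j) - T" for m
  proof -
    have "(\<Sum>j\<in>J. h m j * real (a ! j)) = real (\<Sum>j\<in>J. m j * a ! j) - of_int T * (\<Sum>j\<in>J. s j * real (a ! j))"
      by (simp add: h_def left_diff_distrib sum_subtractf sum_distrib_left mult.assoc)
    also have "(\<Sum>j\<in>J. s j * real (a ! j)) = 1 - of_int s0 * real f"
      using bezout by simp
    finally have "(\<Sum>j\<in>J. h m j * real (a ! j))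
        = of_int (int (\<Sum>j\<in>J. m j * a ! j) - T + int f * (T * s0))"
      by (simp add: algebra_simps)
    moreover have "h m \<in> J \<rightarrow>\<^sub>E \<int>"
      using s by (auto simp: h_def intro!: Ints_diff Ints_mult)
    ultimately have "h m \<in> Lambda a f \<longleftrightarrow>
        (\<exists>k. real_of_int (int (\<Sum>j\<in>J. m j * a ! j) - T + int f * (T * s0)) = of_int (int f * k))"
      by (simp add: Lambda_def J_def[symmetric])
    also have "\<dots> \<longleftrightarrow> int f dvd int (\<Sum>j\<in>J. m j * a ! j) - T + int f * (T * s0)"
      unfolding of_int_eq_iff dvd_def ..
    also have "\<dots> \<longleftrightarrow> int f dvd int (\<Sum>j\<in>J. m j * a ! j) - T"
      by (rule dvd_add_left_iff) simp
    finally show ?thesis .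
  qed
  have translate: "h m \<in> translate J (scale_vec J (- of_int T) s) (nonneg_cone J)" for m
    unfolding h_def translate_def nonneg_cone_def
    by (rule image_eqI[of _ _ "\<lambda>j\<in>J. real (m j)"]) (auto simp: scale_vec_def)
  have "\<exists>m\<in>J \<rightarrow>\<^sub>E UNIV. n = h m" if n: "n \<in> S" for n
  proof -
    obtain x where x: "x \<in> J \<rightarrow>\<^sub>E {0..}" and n_eq: "n = (\<lambda>j\<in>J. scale_vec J (- of_int T) s j + x j)"
      using n by (auto simp: S_def translate_def nonneg_cone_def)
    \<comment> \<open>The cone point \<open>x\<close> is the candidate for \<open>m\<close>. It is
      integral because \<open>n\<close> and \<open>s\<close> are, so the floor only changes its
      type.\<close>
    have "real (nat \<lfloor>x j\<rfloor>) = x j" if j: "j \<in> J" for j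
    proof -
      have "n j \<in> \<int>" "s j \<in> \<int>"
        using n s j by (auto simp: S_def Lambda_def J_def)
      moreover have "x j = n j + of_int T * s j"
        using j by (simp add: n_eq scale_vec_def)
      ultimately have "x j \<in> \<int>"
        by auto
      moreover have "0 \<le> x j"
        using x j by (auto simp: PiE_iff)
      ultimately show ?thesis
        by (auto elim!: Ints_cases)
    qed
    hence "n = h (\<lambda>j\<in>J. nat \<lfloor>x j\<rfloor>)"
      by (auto simp: h_def n_eq scale_vec_def)
    thus ?thesis
      by (intro bexI) auto
  qed
  hence "h ` M = S"
    using Lambda_iff translate unfolding M_def S_def by blast
  moreover have "inj_on h M"
  proof (rule inj_onI)
    fix m m' assume "m \<in> M" "m' \<in> M" and eq: "h m = h m'"
    hence "m \<in> J \<rightarrow>\<^sub>E UNIV" "m' \<in> J \<rightarrow>\<^sub>E UNIV"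
      by (auto simp: M_def)
    thus "m = m'"
    proof (rule PiE_ext)
      fix j assume "j \<in> J"
      thus "m j = m' j"
        using fun_cong[OF eq, of j] by (simp add: h_def)
    qed
  qed
  ultimately show ?thesis
    by (simp add: bij_betw_def h_def M_def S_def)
qed

theorem theorem3p4:
  fixes a :: "nat list" and f :: nat and J :: "nat set"
    and s0 T :: int and s \<xi> :: rvec
  assumes pos: "\<forall>x\<in>set a. 0 < x"
    and f: "is_gcd_of_sublist f a"
    and J: "J = index_set a f"
    and s: "s \<in> J \<rightarrow>\<^sub>E \<int>"
    and bezout: "1 = (\<Sum>j\<in>J. s j * real (a ! j)) + of_int s0 * real f"
    and \<xi>: "\<xi> \<in> J \<rightarrow>\<^sub>E UNIV"
    and neg: "\<forall>j\<in>J. \<xi> j < 0"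
  shows "(\<lambda>n. exp (pairing J \<xi> n)) summable_on
           (translate J (scale_vec J (- of_int T) s) (nonneg_cone J) \<inter> Lambda a f)
       \<and> Q a f T \<xi> =
           complex_of_real (real f * exp (pairing J \<xi> (scale_vec J (of_int T) s)) *
             (\<Sum>\<^sub>\<infinity>n \<in> translate J (scale_vec J (- of_int T) s) (nonneg_cone J) \<inter> Lambda a f.
                exp (pairing J \<xi> n)))"
proof -
  define S where "S = translate J (scale_vec J (- of_int T) s) (nonneg_cone J) \<inter> Lambda a f"
  define M where "M = {m \<in> J \<rightarrow>\<^sub>E UNIV. int f dvd int (\<Sum>j\<in>J. m j * a ! j) - T}"
  define h where "h = (\<lambda>m :: nat \<Rightarrow> nat. \<lambda>j\<in>J. real (m j) - of_int T * s j)"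
  \<comment> \<open>The whole factor in front of the lattice sum; the exponential in it undoes the
    shift from \<open>m\<close> to \<open>h m\<close>.\<close>
  define c where "c = real f * exp (pairing J \<xi> (scale_vec J (of_int T) s))"
  have fpos: "f > 0"
    using is_gcd_of_sublist_pos f pos .
  hence "c \<noteq> 0"
    by (simp add: c_def)
  have "real f * exp (\<Sum>j\<in>J. \<xi> j * real (m j)) = c * exp (pairing J \<xi> (h m))" for m
  proof -
    have "(\<Sum>j\<in>J. \<xi> j * real (m j)) = pairing J \<xi> (scale_vec J (of_int T) s) + pairing J \<xi> (h m)"
      unfolding pairing_def sum.distrib[symmetric]
      by (intro sum.cong refl) (simp add: scale_vec_def h_def algebra_simps)
    thus ?thesis
      by (simp add: c_def exp_add)
  qed
  hence "((\<lambda>m. complex_of_real (c * exp (pairing J \<xi> (h m)))) has_sum Q a f T \<xi>) M"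
    using has_sum_Q[OF fpos, of a \<xi> T] neg by (simp only: J M_def)
  moreover have "bij_betw h M S"
    using bij_betw_shift_lattice_points[of s a f s0 T] s bezout by (simp only: J M_def S_def h_def)
  ultimately have Q: "((\<lambda>n. complex_of_real (c * exp (pairing J \<xi> n))) has_sum Q a f T \<xi>) S"
    using has_sum_reindex_bij_betw[of h M S "\<lambda>n. complex_of_real (c * exp (pairing J \<xi> n))"] by simp
  \<comment> \<open>Real parts turn the complex series into a real one, and dividing by
    \<open>c\<close> shows that the exponentials are summable. Only then is their
    \<open>infsum\<close> a genuine limit rather than the default 0, and uniqueness of the sum
    identifies it with \<open>Q\<close>.\<close>
  have "((\<lambda>n. c * exp (pairing J \<xi> n)) has_sum Re (Q a f T \<xi>)) S"
    using has_sum_Re[OF Q] by simp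
  hence summable: "(\<lambda>n. exp (pairing J \<xi> n)) summable_on S"
    using has_sum_cmult_right_iff[OF \<open>c \<noteq> 0\<close>] by (auto simp: summable_on_def)
  hence "((\<lambda>n. complex_of_real (c * exp (pairing J \<xi> n))) has_sum
      complex_of_real (c * (\<Sum>\<^sub>\<infinity>n\<in>S. exp (pairing J \<xi> n)))) S"
    by (intro has_sum_of_real has_sum_cmult_right has_sum_infsum)
  hence "Q a f T \<xi> = complex_of_real (c * (\<Sum>\<^sub>\<infinity>n\<in>S. exp (pairing J \<xi> n)))"
    using Q has_sum_unique by blast
  with summable show ?thesis
    by (simp add: S_def c_def)
qed

end
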